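(* Let $\alpha,\beta$ be real numbers with bounded partial quotients (badly approximable numbers). For a real $\theta$, let $q_k(\theta)$ denote the denominator of the $k$-th convergent of the continued fraction expansion of $\theta$. Suppose there is a sequence $(\eta_n)_{n\ge 1}$ of real numbers with $0\le \eta_n<1/3$ for every $n$ such that, for all $n$ large enough, (1) $q_{2n}(\beta)^{11/12+\eta_n/4}\le q_{2n}(\alpha)\le q_{2n}(\beta)$, and (2) $\mathrm{lcm}(q_{2n}(\alpha),q_{2n}(\beta))\le q_{2n}(\beta)^{1+\eta_n}$. Then the pair $(\alpha,\beta)$ satisfies the Littlewood conjecture, i.e. $\liminf_{n\to\infty} n\,\|n\alpha\|\,\|n\beta\|=0$.
   Context: $\|x\|$ denotes the distance from the real number $x$ to the nearest integer. *)

theory Defs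
  imports Complex_Main "HOL-Library.Extended_Real"
begin

definition dist_nearest_int :: "real \<Rightarrow> real" where
  "dist_nearest_int x = \<bar>x - of_int (round x)\<bar>"

text \<open>
  Regular continued fraction expansion \<open>\<theta> = [a\<^sub>0; a\<^sub>1, a\<^sub>2, \<dots>]\<close>. For rational \<open>\<theta>\<close> the expansion
  terminates and the sequences below eventually take junk values (through \<open>1 / 0 = 0\<close>); they are
  only meant for irrational \<open>\<theta>\<close>.
\<close>

fun cf_complete_quotient :: "real \<Rightarrow> nat \<Rightarrow> real" where
  "cf_complete_quotient \<theta> 0 = \<theta>"
| "cf_complete_quotient \<theta> (Suc k) = 1 / frac (cf_complete_quotient \<theta> k)"

definition cf_partial_quotient :: "real \<Rightarrow> nat \<Rightarrow> int" where
  "cf_partial_quotient \<theta> k = \<lfloor>cf_complete_quotient \<theta> k\<rfloor>"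

text \<open>
  The convergents are indexed from \<open>0\<close>, with \<open>p\<^sub>0/q\<^sub>0 = a\<^sub>0/1\<close>.
\<close>

fun cf_denom :: "real \<Rightarrow> nat \<Rightarrow> int" where
  "cf_denom \<theta> 0 = 1"
| "cf_denom \<theta> (Suc 0) = cf_partial_quotient \<theta> 1"
| "cf_denom \<theta> (Suc (Suc k)) =
     cf_partial_quotient \<theta> (Suc (Suc k)) * cf_denom \<theta> (Suc k) + cf_denom \<theta> k"

text \<open>
  Badly approximable numbers are irrational, so that the expansion is infinite.
\<close>

definition bounded_partial_quotients :: "real \<Rightarrow> bool" where
  "bounded_partial_quotients \<theta> \<longleftrightarrow>
     \<theta> \<notin> \<rat> \<and> (\<exists>M. \<forall>k\<ge>1. cf_partial_quotient \<theta> k \<le> M)"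

definition littlewood_pair :: "real \<Rightarrow> real \<Rightarrow> bool" where
  "littlewood_pair \<alpha> \<beta> \<longleftrightarrow>
     liminf (\<lambda>n. ereal (real n * dist_nearest_int (real n * \<alpha>) * dist_nearest_int (real n * \<beta>))) = 0"

end

theory Submission
  imports Defs "HOL-Number_Theory.Cong" "HOL-Library.FuncSet"
begin

text \<open>
  Write \<open>q = q\<^sub>2\<^sub>n(\<alpha>)\<close>, \<open>Q = q\<^sub>2\<^sub>n(\<beta>)\<close> and \<open>d\<^sub>n = gcd q Q\<close>; the hypotheses give \<open>d\<^sub>n \<ge> Q\<^bsup>2/3\<^esup>\<close>.
  The integer \<open>L = lcm q Q\<close> satisfies \<open>L \<parallel>L\<alpha>\<parallel> \<parallel>L\<beta>\<parallel> \<le> L\<^sup>3 / (q\<^sup>2 Q\<^sup>2)\<close>, but if \<open>\<eta>\<^sub>n\<close> tends to \<open>1/3\<close> the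
  hypotheses only bound this by a constant, so one first improves the bound on \<open>L\<close> to \<open>L \<le> C Q\<close>.

  Let \<open>x = (q\<^sub>2\<^sub>n\<^sub>-\<^sub>1(\<alpha>), q\<^sub>2\<^sub>n(\<alpha>))\<close> and \<open>y = (q\<^sub>2\<^sub>n\<^sub>-\<^sub>1(\<beta>), q\<^sub>2\<^sub>n(\<beta>))\<close>. Since the partial quotients are bounded,
  \<open>q\<^sub>2\<^sub>n\<^sub>+\<^sub>2\<^sub>k\<close> is a linear form in \<open>x\<close> (respectively \<open>y\<close>) with bounded coefficients. By Siegel's lemma there is a
  nonzero integer form \<open>F\<close> with bounded coefficients, of degree \<open>2\<close> in \<open>x\<close> and \<open>1\<close> in \<open>y\<close> (six monomials), that
  vanishes on the common zeros of the two linear forms for each \<open>k = 0, \<dots>, 4\<close> (for \<open>k = 0\<close> this just drops the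
  monomial \<open>x\<^sub>0\<^sup>2 y\<^sub>0\<close>). Hence every \<open>d\<^sub>n\<^sub>+\<^sub>k\<close> divides a bounded multiple of \<open>F(x, y)\<close>. The \<open>d\<^sub>n\<^sub>+\<^sub>k\<close> have bounded
  pairwise gcds and their product is at least \<open>Q\<^bsup>10/3\<^esup>\<close>, whereas \<open>F(x, y)\<close> is \<open>O(Q\<^sup>3)\<close>; so \<open>F(x, y) = 0\<close>
  for large \<open>n\<close>. This equation forces \<open>q / d\<^sub>n\<close> to divide a nonzero coefficient of \<open>F\<close>, whence \<open>L = (q / d\<^sub>n) Q \<le> C Q\<close>
  and \<open>L\<^sup>3 / (q\<^sup>2 Q\<^sup>2) \<le> C\<^sup>3 Q / q\<^sup>2\<close>, which tends to \<open>0\<close>.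
\<close>

section \<open>Continued fractions\<close>

text \<open>Irrationality keeps every fractional part nonzero, so the junk value
  \<open>1 / 0\<close> never enters the expansion.\<close>

lemma cf_complete_quotient_irrational:
  assumes "\<theta> \<notin> \<rat>"
  shows "cf_complete_quotient \<theta> k \<notin> \<rat>"
proof (induction k)
  case 0
  then show ?case using assms by simp
next
  case (Suc k)
  let ?x = "cf_complete_quotient \<theta> k"
  show ?case
  proof
    assume "cf_complete_quotient \<theta> (Suc k) \<in> \<rat>"
    then have "1 / (1 / frac ?x) \<in> \<rat>"
      unfolding cf_complete_quotient.simps by (rule Rats_divide[OF Rats_1])
    then have "frac ?x \<in> \<rat>" by (simp only: div_by_1 divide_divide_eq_right mult_1)
    then have "frac ?x + of_int \<lfloor>?x\<rfloor> \<in> \<rat>" by (intro Rats_add) auto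
    moreover have "frac ?x + of_int \<lfloor>?x\<rfloor> = ?x" by (simp add: frac_def)
    ultimately show False using Suc by metis
  qed
qed

lemma frac_cf_complete_quotient_pos:
  assumes "\<theta> \<notin> \<rat>"
  shows "0 < frac (cf_complete_quotient \<theta> k)"
proof -
  have "cf_complete_quotient \<theta> k \<notin> \<int>"
    using cf_complete_quotient_irrational[OF assms] Ints_subset_Rats by blast
  then show ?thesis by simp
qed

lemma cf_complete_quotient_gt_1:
  assumes "\<theta> \<notin> \<rat>" and "k \<ge> 1"
  shows "1 < cf_complete_quotient \<theta> k"
proof -
  obtain j where j: "k = Suc j" using assms(2) by (cases k) auto
  show ?thesis
    using frac_cf_complete_quotient_pos[OF assms(1), of j] frac_lt_1[of "cf_complete_quotient \<theta> j"]
    by (simp add: j)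
qed

lemma cf_partial_quotient_ge_1:
  assumes "\<theta> \<notin> \<rat>" and "k \<ge> 1"
  shows "1 \<le> cf_partial_quotient \<theta> k"
  using cf_complete_quotient_gt_1[OF assms] by (simp add: cf_partial_quotient_def le_floor_iff)

lemma cf_denom_pos:
  assumes "\<theta> \<notin> \<rat>"
  shows "0 < cf_denom \<theta> k"
proof (induction k rule: induct_nat_012)
  case 1
  then show ?case using cf_partial_quotient_ge_1[OF assms, of 1] by simp
next
  case (ge2 n)
  then show ?case using cf_partial_quotient_ge_1[OF assms, of "Suc (Suc n)"]
    by (simp add: add_pos_pos)
qed simp

lemma cf_denom_Suc_ge:
  assumes "\<theta> \<notin> \<rat>"
  shows "cf_denom \<theta> k \<le> cf_denom \<theta> (Suc k)"
proof (cases k)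
  case 0
  then show ?thesis using cf_partial_quotient_ge_1[OF assms, of 1] by simp
next
  case (Suc j)
  have "1 * cf_denom \<theta> (Suc j) \<le> cf_partial_quotient \<theta> (Suc (Suc j)) * cf_denom \<theta> (Suc j)"
    using cf_partial_quotient_ge_1[OF assms, of "Suc (Suc j)"] cf_denom_pos[OF assms, of "Suc j"]
    by (intro mult_right_mono) auto
  then show ?thesis using cf_denom_pos[OF assms, of j] by (simp add: Suc)
qed

lemma cf_denom_mono:
  assumes "\<theta> \<notin> \<rat>" and "j \<le> k"
  shows "cf_denom \<theta> j \<le> cf_denom \<theta> k"
  using lift_Suc_mono_le[of "cf_denom \<theta>", OF cf_denom_Suc_ge[OF assms(1)] assms(2)] .

text \<open>Two steps of the recursion raise the denominator by at least 1; a single step need not,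
  since q_1 = q_0 can occur.\<close>

lemma cf_denom_even_ge:
  assumes "\<theta> \<notin> \<rat>"
  shows "int n < cf_denom \<theta> (2 * n)"
proof (induction n)
  case (Suc n)
  have "1 * cf_denom \<theta> (Suc (2 * n)) \<le> cf_partial_quotient \<theta> (Suc (Suc (2 * n))) * cf_denom \<theta> (Suc (2 * n))"
    using cf_partial_quotient_ge_1[OF assms, of "Suc (Suc (2 * n))"] cf_denom_pos[OF assms, of "Suc (2 * n)"]
    by (intro mult_right_mono) auto
  then have "int (Suc n) < cf_denom \<theta> (Suc (Suc (2 * n)))"
    using Suc cf_denom_pos[OF assms, of "Suc (2 * n)"] unfolding cf_denom.simps by linarith
  then show ?case by simp
qed simp

lemma coprime_cf_denom_Suc: "coprime (cf_denom \<theta> k) (cf_denom \<theta> (Suc k))"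
proof (induction k)
  case (Suc k)
  then have "coprime (cf_denom \<theta> (Suc k))
      (cf_partial_quotient \<theta> (Suc (Suc k)) * cf_denom \<theta> (Suc k) + cf_denom \<theta> k)"
    by (metis coprime_commute coprime_iff_gcd_eq_1 gcd_add_mult)
  then show ?case by simp
qed simp

section \<open>Linear relations and common divisors among denominators\<close>

text \<open>Unrolling the recursion multiplies the coefficient bound by at most \<open>M + 1\<close>
  per step. The lower bound on \<open>v\<close> matters: it keeps the later multipliers
  \<open>v\<^sup>2 * t\<close> nonzero and bounds gcds.\<close>

lemma cf_denom_block:
  assumes irr: "\<theta> \<notin> \<rat>" and M: "\<And>k. k \<ge> 1 \<Longrightarrow> cf_partial_quotient \<theta> k \<le> M"
  shows "\<exists>u v. 0 \<le> u \<and> u \<le> (M + 1) ^ j \<and> 1 \<le> v \<and> v \<le> (M + 1) ^ j \<and>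
           cf_denom \<theta> (Suc m + j) = u * cf_denom \<theta> m + v * cf_denom \<theta> (Suc m)"
proof (induction j rule: induct_nat_012)
  case 0
  show ?case by (intro exI[of _ 0] exI[of _ 1]) auto
next
  case 1
  show ?case
    using cf_partial_quotient_ge_1[OF irr, of "Suc (Suc m)"] M[of "Suc (Suc m)"]
    by (intro exI[of _ 1] exI[of _ "cf_partial_quotient \<theta> (Suc (Suc m))"]) auto
next
  case (ge2 j)
  obtain u v where uv: "0 \<le> u" "u \<le> (M + 1) ^ j" "1 \<le> v" "v \<le> (M + 1) ^ j"
      "cf_denom \<theta> (Suc m + j) = u * cf_denom \<theta> m + v * cf_denom \<theta> (Suc m)"
    using ge2.IH(1) by blast
  obtain u' v' where uv': "0 \<le> u'" "u' \<le> (M + 1) ^ Suc j" "1 \<le> v'" "v' \<le> (M + 1) ^ Suc j"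
      "cf_denom \<theta> (Suc m + Suc j) = u' * cf_denom \<theta> m + v' * cf_denom \<theta> (Suc m)"
    using ge2.IH(2) by blast
  define a where "a = cf_partial_quotient \<theta> (Suc (Suc (Suc m + j)))"
  have a: "1 \<le> a" "a \<le> M"
    using cf_partial_quotient_ge_1[OF irr, of "Suc (Suc (Suc m + j))"] M[of "Suc (Suc (Suc m + j))"]
    by (auto simp: a_def)
  have le: "a * z + w \<le> (M + 1) ^ Suc (Suc j)"
    if "0 \<le> z" "z \<le> (M + 1) ^ Suc j" "w \<le> (M + 1) ^ j" for z w
  proof -
    have "a * z \<le> M * (M + 1) ^ Suc j" using that a by (intro mult_mono) auto
    moreover have "(M + 1) ^ j * 1 \<le> (M + 1) ^ j * (M + 1)" using a by (intro mult_left_mono) auto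
    ultimately show ?thesis using that(3) by (simp add: algebra_simps)
  qed
  have "cf_denom \<theta> (Suc m + Suc (Suc j)) = a * cf_denom \<theta> (Suc m + Suc j) + cf_denom \<theta> (Suc m + j)"
    by (simp add: a_def)
  also have "\<dots> = (a * u' + u) * cf_denom \<theta> m + (a * v' + v) * cf_denom \<theta> (Suc m)"
    unfolding uv(5) uv'(5) by (simp add: algebra_simps)
  finally have "cf_denom \<theta> (Suc m + Suc (Suc j)) =
      (a * u' + u) * cf_denom \<theta> m + (a * v' + v) * cf_denom \<theta> (Suc m)" .
  moreover have "0 \<le> a * u' + u" "1 \<le> a * v' + v" using a uv uv' by (simp_all add: add_increasing)
  moreover have "a * u' + u \<le> (M + 1) ^ Suc (Suc j)" "a * v' + v \<le> (M + 1) ^ Suc (Suc j)"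
    using le uv uv' by auto
  ultimately show ?case by blast
qed

text \<open>A common divisor divides v q_{m+1}, where v is the block coefficient; it is coprime to
  q_{m+1} because it divides q_m, hence it divides v.\<close>

lemma gcd_cf_denom_le:
  assumes irr: "\<theta> \<notin> \<rat>" and M: "\<And>k. k \<ge> 1 \<Longrightarrow> cf_partial_quotient \<theta> k \<le> M"
  shows "gcd (cf_denom \<theta> m) (cf_denom \<theta> (Suc m + j)) \<le> (M + 1) ^ j"
proof -
  obtain u v where uv: "1 \<le> v" "v \<le> (M + 1) ^ j"
      "cf_denom \<theta> (Suc m + j) = u * cf_denom \<theta> m + v * cf_denom \<theta> (Suc m)"
    using cf_denom_block[OF irr M, of j m] by blast
  let ?g = "gcd (cf_denom \<theta> m) (cf_denom \<theta> (Suc m + j))"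
  have "?g dvd u * cf_denom \<theta> m + v * cf_denom \<theta> (Suc m)"
    by (metis gcd_dvd2 uv(3))
  then have "?g dvd v * cf_denom \<theta> (Suc m)"
    by (metis dvd_add_right_iff dvd_mult gcd_dvd1)
  moreover have "coprime ?g (cf_denom \<theta> (Suc m))"
    using coprime_cf_denom_Suc[of \<theta> m] by (rule coprime_divisors[rotated 2]) auto
  ultimately have "?g dvd v" by (simp add: coprime_dvd_mult_left_iff)
  then have "?g \<le> v" using uv(1) by (intro zdvd_imp_le) auto
  then show ?thesis using uv(2) by simp
qed

section \<open>Approximation by convergents\<close>

text \<open>
  Writing \<open>e\<^sub>k = q\<^sub>k \<theta> - p\<^sub>k\<close>, the two relations \<open>e\<^sub>k = - \<theta>\<^sub>k\<^sub>+\<^sub>2 e\<^sub>k\<^sub>+\<^sub>1\<close> and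
  \<open>\<bar>e\<^sub>k\<^sub>+\<^sub>1\<bar> (\<theta>\<^sub>k\<^sub>+\<^sub>2 q\<^sub>k\<^sub>+\<^sub>1 + q\<^sub>k) = 1\<close> are preserved together by the recursion.
\<close>

lemma cf_denom_error_invariant:
  fixes \<theta> :: real
  assumes irr: "\<theta> \<notin> \<rat>"
  shows "\<exists>(p::int) (p'::int).
      cf_denom \<theta> k * \<theta> - p = - cf_complete_quotient \<theta> (Suc (Suc k)) * (cf_denom \<theta> (Suc k) * \<theta> - p') \<and>
      \<bar>cf_denom \<theta> (Suc k) * \<theta> - p'\<bar> *
        (cf_complete_quotient \<theta> (Suc (Suc k)) * cf_denom \<theta> (Suc k) + cf_denom \<theta> k) = 1"
proof (induction k)
  case 0
  define f0 where "f0 = frac \<theta>"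
  define f1 where "f1 = frac (1 / f0)"
  have pos: "0 < f0" "0 < f1"
    using frac_cf_complete_quotient_pos[OF irr, of 0] frac_cf_complete_quotient_pos[OF irr, of 1]
    by (auto simp: f0_def f1_def)
  define q where "q = cf_denom \<theta> (Suc 0)"
  have q: "real_of_int q = 1 / f0 - f1"
    by (simp add: q_def cf_partial_quotient_def f0_def f1_def frac_def)
  have f0: "\<theta> - \<lfloor>\<theta>\<rfloor> = f0" by (simp add: f0_def frac_def)
  \<comment> \<open>The numerators are p_0 = a_0 and p_1 = a_1 a_0 + 1, with errors
    \<open>f0\<close> and \<open>- (f0 * f1)\<close>.\<close>
  have "q * \<theta> - of_int (q * \<lfloor>\<theta>\<rfloor> + 1) = q * (\<theta> - \<lfloor>\<theta>\<rfloor>) - 1" by (simp add: algebra_simps)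
  also have "\<dots> = - (f0 * f1)" unfolding f0 q using pos by (simp add: field_simps)
  finally have e1: "q * \<theta> - of_int (q * \<lfloor>\<theta>\<rfloor> + 1) = - (f0 * f1)" .
  have t2: "cf_complete_quotient \<theta> (Suc (Suc 0)) = 1 / f1" by (simp add: f0_def f1_def)
  show ?case
    unfolding t2 q_def[symmetric]
  proof (intro exI conjI)
    show "cf_denom \<theta> 0 * \<theta> - \<lfloor>\<theta>\<rfloor> = - (1 / f1) * (q * \<theta> - of_int (q * \<lfloor>\<theta>\<rfloor> + 1))"
      unfolding e1 using f0 pos by simp
    show "\<bar>q * \<theta> - of_int (q * \<lfloor>\<theta>\<rfloor> + 1)\<bar> * (1 / f1 * q + cf_denom \<theta> 0) = 1"
      unfolding e1 unfolding q using pos by (simp add: field_simps)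
  qed
next
  case (Suc k)
  then obtain p p' :: int where
    e: "cf_denom \<theta> k * \<theta> - p = - cf_complete_quotient \<theta> (Suc (Suc k)) * (cf_denom \<theta> (Suc k) * \<theta> - p')"
    and one: "\<bar>cf_denom \<theta> (Suc k) * \<theta> - p'\<bar> *
        (cf_complete_quotient \<theta> (Suc (Suc k)) * cf_denom \<theta> (Suc k) + cf_denom \<theta> k) = 1"
    by blast
  define t where "t = cf_complete_quotient \<theta> (Suc (Suc k))"
  define e' where "e' = cf_denom \<theta> (Suc k) * \<theta> - p'"
  define a where "a = cf_partial_quotient \<theta> (Suc (Suc k))"
  have f: "0 < frac t" using frac_cf_complete_quotient_pos[OF irr] by (simp add: t_def del: cf_complete_quotient.simps)
  have a: "real_of_int a = t - frac t" by (simp add: a_def t_def cf_partial_quotient_def frac_def)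
  have t3: "cf_complete_quotient \<theta> (Suc (Suc (Suc k))) = 1 / frac t" by (simp add: t_def)
  have q: "cf_denom \<theta> (Suc (Suc k)) = a * cf_denom \<theta> (Suc k) + cf_denom \<theta> k" by (simp add: a_def)
  \<comment> \<open>The new numerator \<open>a * p' + p\<close> obeys the same recursion as the
    denominators, and the error shrinks by the factor \<open>- frac t\<close>.\<close>
  have "cf_denom \<theta> (Suc (Suc k)) * \<theta> - of_int (a * p' + p) = a * e' + (cf_denom \<theta> k * \<theta> - p)"
    unfolding q by (simp add: e'_def algebra_simps)
  also have "\<dots> = - (frac t * e')" unfolding e t_def[symmetric] e'_def[symmetric] a by (simp add: algebra_simps)
  finally have e'': "cf_denom \<theta> (Suc (Suc k)) * \<theta> - of_int (a * p' + p) = - (frac t * e')" .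
  have "\<bar>- (frac t * e')\<bar> * (1 / frac t * cf_denom \<theta> (Suc (Suc k)) + cf_denom \<theta> (Suc k))
      = \<bar>e'\<bar> * (cf_denom \<theta> (Suc (Suc k)) + frac t * cf_denom \<theta> (Suc k))"
    using f by (simp add: abs_mult field_simps)
  also have "\<dots> = \<bar>e'\<bar> * (t * cf_denom \<theta> (Suc k) + cf_denom \<theta> k)"
    unfolding q by (simp add: a algebra_simps)
  also have "\<dots> = 1" using one by (simp only: t_def e'_def)
  finally have "\<bar>- (frac t * e')\<bar> * (1 / frac t * cf_denom \<theta> (Suc (Suc k)) + cf_denom \<theta> (Suc k)) = 1" .
  moreover have "e' = - (1 / frac t) * (- (frac t * e'))" using f by simp
  ultimately show ?case unfolding t3 using e'' unfolding e'_def by metis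
qed

text \<open>The second relation of the invariant is an equality with right side 1; as \<theta>_{k+2}
  > 1, its second factor is at least q_{k+1}.\<close>

lemma cf_denom_approx:
  fixes \<theta> :: real
  assumes irr: "\<theta> \<notin> \<rat>"
  shows "\<exists>p::int. \<bar>cf_denom \<theta> (Suc k) * \<theta> - p\<bar> \<le> 1 / cf_denom \<theta> (Suc k)"
proof -
  let ?t = "cf_complete_quotient \<theta> (Suc (Suc k))"
  obtain p' :: int where one: "\<bar>cf_denom \<theta> (Suc k) * \<theta> - p'\<bar> * (?t * cf_denom \<theta> (Suc k) + cf_denom \<theta> k) = 1"
    using cf_denom_error_invariant[OF irr, of k] by blast
  have pos: "0 < cf_denom \<theta> (Suc k)" "0 < cf_denom \<theta> k" using cf_denom_pos[OF irr] by auto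
  have "1 * real_of_int (cf_denom \<theta> (Suc k)) \<le> ?t * cf_denom \<theta> (Suc k)"
    using cf_complete_quotient_gt_1[OF irr, of "Suc (Suc k)"] pos by (intro mult_right_mono) auto
  then have "cf_denom \<theta> (Suc k) \<le> ?t * cf_denom \<theta> (Suc k) + cf_denom \<theta> k" using pos by linarith
  then have "\<bar>cf_denom \<theta> (Suc k) * \<theta> - p'\<bar> * cf_denom \<theta> (Suc k) \<le> 1"
    unfolding one[symmetric] by (intro mult_left_mono) auto
  then show ?thesis using pos by (intro exI[of _ p']) (simp add: field_simps)
qed

lemma dist_nearest_int_le: "dist_nearest_int x \<le> \<bar>x - of_int m\<bar>"
  unfolding dist_nearest_int_def by (rule round_diff_minimal)

lemma dist_nearest_int_multiple_cf_denom:
  assumes irr: "\<theta> \<notin> \<rat>" and "cf_denom \<theta> (Suc k) dvd l" and "0 \<le> l"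
  shows "dist_nearest_int (of_int l * \<theta>) \<le> of_int l / (of_int (cf_denom \<theta> (Suc k)))\<^sup>2"
proof -
  define q where "q = cf_denom \<theta> (Suc k)"
  have q: "0 < q" using cf_denom_pos[OF irr] by (simp add: q_def)
  obtain c where c: "l = q * c" using assms(2) by (auto simp: q_def)
  have "0 \<le> c" using assms(3) q by (simp add: c zero_le_mult_iff)
  obtain p :: int where p: "\<bar>q * \<theta> - p\<bar> \<le> 1 / q" using cf_denom_approx[OF irr] by (auto simp: q_def)
  have "dist_nearest_int (of_int l * \<theta>) \<le> \<bar>of_int l * \<theta> - of_int (c * p)\<bar>"
    by (rule dist_nearest_int_le)
  also have "\<dots> = c * \<bar>q * \<theta> - p\<bar>"
  proof -
    have "of_int l * \<theta> - of_int (c * p) = c * (q * \<theta> - p)" by (simp add: c algebra_simps)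
    then show ?thesis using \<open>0 \<le> c\<close> by (simp add: abs_mult)
  qed
  also have "\<dots> \<le> c * (1 / q)" using p \<open>0 \<le> c\<close> by (intro mult_left_mono) auto
  also have "\<dots> = of_int l / (of_int q)\<^sup>2" using q by (simp add: c power2_eq_square field_simps)
  finally show ?thesis by (simp add: q_def)
qed

section \<open>Integer arithmetic\<close>

text \<open>Two points of the box {0..H}^n have the same image under A, and their difference is the
  solution. The bound is cruder than the optimal exponent, but depends only on m, n and M.\<close>

lemma siegel_pigeonhole:
  fixes A :: "nat \<Rightarrow> nat \<Rightarrow> int" and M :: nat
  assumes "m < n" and A: "\<And>i j. i < m \<Longrightarrow> j < n \<Longrightarrow> \<bar>A i j\<bar> \<le> int M"
  shows "\<exists>z. (\<forall>j<n. \<bar>z j\<bar> \<le> (2 * int n * int M + 1) ^ m) \<and> (\<exists>j<n. z j \<noteq> 0) \<and>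
           (\<forall>i<m. (\<Sum>j<n. A i j * z j) = 0)"
proof -
  define H where "H = (2 * n * M + 1) ^ m"
  define Z where "Z = (\<Pi>\<^sub>E j\<in>{..<n}. {0..int H})"
  define W where "W = (\<Pi>\<^sub>E i\<in>{..<m}. {- int (n * M * H)..int (n * M * H)})"
  define f where "f z = (\<lambda>i\<in>{..<m}. \<Sum>j<n. A i j * z j)" for z :: "nat \<Rightarrow> int"
  have cardZ: "card Z = (H + 1) ^ n" by (simp add: Z_def card_PiE nat_add_distrib)
  have cardW: "card W = (2 * (n * M * H) + 1) ^ m"
  proof -
    have "nat (int (n * M * H) + 1 + int (n * M * H)) = 2 * (n * M * H) + 1" by linarith
    then show ?thesis by (simp add: W_def card_PiE)
  qed
  have "f ` Z \<subseteq> W"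
  proof
    fix w assume "w \<in> f ` Z"
    then obtain z where z: "z \<in> Z" "w = f z" by blast
    have "\<bar>\<Sum>j<n. A i j * z j\<bar> \<le> int (n * M * H)" if "i < m" for i
    proof -
      have "\<bar>\<Sum>j<n. A i j * z j\<bar> \<le> (\<Sum>j<n. \<bar>A i j * z j\<bar>)" by (rule sum_abs)
      also have "\<dots> \<le> (\<Sum>j<n. int M * int H)"
      proof (rule sum_mono)
        fix j assume "j \<in> {..<n}"
        then have "z j \<in> {0..int H}" using PiE_mem[OF z(1)[unfolded Z_def]] by blast
        then show "\<bar>A i j * z j\<bar> \<le> int M * int H"
          unfolding abs_mult using A[OF that, of j] \<open>j \<in> {..<n}\<close> by (intro mult_mono) simp_all
      qed
      finally show ?thesis by simp
    qed
    then show "w \<in> W" unfolding W_def z(2) f_def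
      by (intro PiE_I) (simp_all add: abs_le_iff minus_le_iff)
  qed
  moreover have "card W < card Z"
  proof -
    \<comment> \<open>Each image coordinate takes at most (2nM+1)(H+1) values. Since H = (2nM+1)^m,
      there are at most H (H+1)^m images, fewer than the (H+1)^n points.\<close>
    have "2 * (k * H) + 1 \<le> (2 * k + 1) * (H + 1)" for k by (simp add: algebra_simps)
    from this[of "n * M"] have "2 * (n * M * H) + 1 \<le> (2 * n * M + 1) * (H + 1)" by (simp only: mult.assoc)
    then have "card W \<le> ((2 * n * M + 1) * (H + 1)) ^ m" unfolding cardW by (rule power_mono) simp
    also have "\<dots> = H * (H + 1) ^ m" by (simp only: power_mult_distrib H_def)
    also have "\<dots> < (H + 1) ^ Suc m" by simp
    also have "\<dots> \<le> (H + 1) ^ n" using assms(1) by (intro power_increasing) auto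
    finally show ?thesis by (simp add: cardZ)
  qed
  moreover have "finite W" by (simp add: W_def finite_PiE)
  ultimately have "\<not> inj_on f Z" by (metis card_inj_on_le not_le)
  then obtain z z' where z: "z \<in> Z" "z' \<in> Z" "z \<noteq> z'" "f z = f z'" by (auto simp: inj_on_def)
  have "\<bar>z j - z' j\<bar> \<le> (2 * int n * int M + 1) ^ m" if "j < n" for j
  proof -
    have "z j \<in> {0..int H}" "z' j \<in> {0..int H}"
      using PiE_mem[OF z(1)[unfolded Z_def]] PiE_mem[OF z(2)[unfolded Z_def]] that by simp_all
    then have "\<bar>z j - z' j\<bar> \<le> int H" by auto
    then show ?thesis by (simp add: H_def add.commute)
  qed
  moreover have "\<exists>j<n. z j - z' j \<noteq> 0"
  proof (rule ccontr)
    assume "\<not> (\<exists>j<n. z j - z' j \<noteq> 0)"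
    then have "z = z'" using PiE_ext[OF z(1,2)[unfolded Z_def]] by simp
    then show False using z(3) by simp
  qed
  moreover have "(\<Sum>j<n. A i j * (z j - z' j)) = 0" if "i < m" for i
    using fun_cong[OF z(4), of i] that by (simp add: f_def right_diff_distrib sum_subtractf)
  ultimately show ?thesis by (intro exI[of _ "\<lambda>j. z j - z' j"]) auto
qed

section \<open>Products of divisors with small pairwise gcds\<close>

lemma gcd_mult_dvd_mult_gcd:
  fixes a b c :: int
  shows "gcd a (b * c) dvd gcd a b * gcd a c"
proof -
  let ?d = "gcd a (b * c)"
  have "?d dvd gcd (c * a) (c * b)"
    by (metis dvd_mult gcd_dvd1 gcd_dvd2 gcd_greatest mult.commute)
  then have "?d dvd \<bar>c * gcd a b\<bar>" by (simp add: gcd_mult_left abs_mult)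
  then have "?d dvd gcd a b * c" by (simp only: dvd_abs_iff mult.commute)
  moreover have "?d dvd gcd a b * a" by (simp add: dvd_mult)
  ultimately have "?d dvd gcd (gcd a b * a) (gcd a b * c)" by (rule gcd_greatest[rotated])
  then show ?thesis by (simp only: gcd_mult_left dvd_normalize_iff)
qed

lemma gcd_prod_dvd_power:
  fixes a g :: int
  assumes "\<And>i. i < r \<Longrightarrow> gcd a (b i) dvd g"
  shows "gcd a (\<Prod>i<r. b i) dvd g ^ r"
  using assms
proof (induction r)
  case (Suc r)
  have "gcd a (\<Prod>i<Suc r. b i) dvd gcd a (\<Prod>i<r. b i) * gcd a (b r)"
    using gcd_mult_dvd_mult_gcd by simp
  also have "\<dots> dvd g ^ r * g" using Suc by (intro mult_dvd_mono) auto
  finally show ?case by (simp add: mult.commute)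
qed simp

text \<open>Adjoining a_r to the product P, use P a_r = lcm * gcd up to sign: the lcm divides the
  old multiple of N and the gcd divides g^r. The exponent r^2 is generous, as r^2 + r \<le>
  (r+1)^2.\<close>

lemma prod_dvd_of_gcd_dvd:
  fixes a :: "nat \<Rightarrow> int" and g N :: int
  assumes "\<And>i. i < r \<Longrightarrow> a i dvd N" and "\<And>i j. i < j \<Longrightarrow> j < r \<Longrightarrow> gcd (a i) (a j) dvd g"
  shows "(\<Prod>i<r. a i) dvd g ^ (r * r) * N"
  using assms
proof (induction r)
  case (Suc r)
  let ?P = "\<Prod>i<r. a i"
  have "?P dvd g ^ (r * r) * N" using Suc by auto
  moreover have "a r dvd g ^ (r * r) * N" using Suc.prems(1) by (simp add: dvd_mult)
  ultimately have "lcm ?P (a r) dvd g ^ (r * r) * N" by (rule lcm_least)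
  moreover have "gcd (a r) ?P dvd g ^ r"
    using Suc.prems(2) by (intro gcd_prod_dvd_power) (simp add: gcd.commute)
  ultimately have "lcm ?P (a r) * gcd ?P (a r) dvd g ^ (r * r) * N * g ^ r"
    by (intro mult_dvd_mono) (simp_all add: gcd.commute)
  moreover have "?P * a r dvd lcm ?P (a r) * gcd ?P (a r)"
    by (simp add: lcm_mult_gcd abs_mult[symmetric] del: abs_mult)
  ultimately have "?P * a r dvd g ^ (r * r) * N * g ^ r" by (rule dvd_trans[rotated])
  also have "g ^ (r * r) * N * g ^ r = g ^ (r * r + r) * N" by (simp add: power_add)
  also have "\<dots> dvd g ^ (Suc r * Suc r) * N" by (intro mult_dvd_mono le_imp_power_dvd) auto
  finally show ?case by simp
qed simp

section \<open>The auxiliary form of bidegree (2,1)\<close>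

text \<open>\<open>van\<close> says that F vanishes at (v, -u), (t, -s), the common zero of the two
  linear forms. Scaling x by v and y by t multiplies F by \<open>v\<^sup>2 * t\<close> and allows v
  x1 and t y1 to be replaced mod d by - u x0 and - s y0, without inverting v or t.\<close>

lemma dvd_form_of_vanishing:
  fixes d :: int
  assumes "d dvd u * x0 + v * x1" and "d dvd s * y0 + t * y1"
    and van: "c0 * (v\<^sup>2 * - s) + c1 * (v * - u * t) + c2 * (v * u * s) + c3 * (u\<^sup>2 * t) + c4 * (u\<^sup>2 * - s) = 0"
  shows "d dvd v\<^sup>2 * t * (c0 * (x0\<^sup>2 * y1) + c1 * (x0 * x1 * y0) + c2 * (x0 * x1 * y1) +
           c3 * (x1\<^sup>2 * y0) + c4 * (x1\<^sup>2 * y1))"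
proof -
  define F where "F a b e f = c0 * (a\<^sup>2 * f) + c1 * (a * b * e) + c2 * (a * b * f) +
      c3 * (b\<^sup>2 * e) + c4 * (b\<^sup>2 * f)" for a b e f
  have "[v * x1 = - u * x0] (mod d)" "[t * y1 = - s * y0] (mod d)"
    using assms(1,2) by (simp_all add: cong_iff_dvd_diff add.commute)
  moreover have "[F a b e f = F a b' e f'] (mod d)" if "[b = b'] (mod d)" "[f = f'] (mod d)" for a b b' e f f'
    unfolding F_def by (intro cong_add cong_mult cong_pow cong_refl that)
  ultimately have "[F (v * x0) (v * x1) (t * y0) (t * y1) = F (v * x0) (- u * x0) (t * y0) (- s * y0)] (mod d)"
    by blast
  moreover have "F (v * x0) (- u * x0) (t * y0) (- s * y0) = x0\<^sup>2 * y0 *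
      (c0 * (v\<^sup>2 * - s) + c1 * (v * - u * t) + c2 * (v * u * s) + c3 * (u\<^sup>2 * t) + c4 * (u\<^sup>2 * - s))"
    unfolding F_def by (simp add: algebra_simps power2_eq_square)
  moreover have "F (v * x0) (v * x1) (t * y0) (t * y1) = v\<^sup>2 * t * F x0 x1 y0 y1"
    unfolding F_def by (simp add: algebra_simps power2_eq_square)
  ultimately have "[v\<^sup>2 * t * F x0 x1 y0 y1 = 0] (mod d)" by (simp only: van mult_zero_right)
  then show ?thesis by (simp add: cong_0_iff F_def)
qed

text \<open>With x1 = d a and y1 = d b, the coefficients are examined in turn. First a divides c0,
  so either a \<le> H or c0 = 0. Then d divides c1, and d > H forces c1 = 0. Next a divides c2. If
  c2 = 0 as well, y1 divides c3, so c3 = c4 = 0, contrary to \<open>nz\<close>.\<close>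

lemma cofactor_le_of_form_eq_0:
  fixes H :: int
  assumes cop: "coprime x0 x1" "coprime y0 y1" and pos: "0 < x1" "0 < y1" "x0 \<noteq> 0"
    and F: "c0 * (x0\<^sup>2 * y1) + c1 * (x0 * x1 * y0) + c2 * (x0 * x1 * y1) +
           c3 * (x1\<^sup>2 * y0) + c4 * (x1\<^sup>2 * y1) = 0"
    and c: "\<bar>c0\<bar> \<le> H" "\<bar>c1\<bar> \<le> H" "\<bar>c2\<bar> \<le> H" "\<bar>c3\<bar> \<le> H"
    and nz: "c0 \<noteq> 0 \<or> c1 \<noteq> 0 \<or> c2 \<noteq> 0 \<or> c3 \<noteq> 0 \<or> c4 \<noteq> 0"
    and H: "H < gcd x1 y1"
  shows "x1 div gcd x1 y1 \<le> H"
proof -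
  define d where "d = gcd x1 y1"
  define a b where "a = x1 div d" and "b = y1 div d"
  have d: "0 < d" using pos by (simp add: d_def)
  have x1: "x1 = d * a" and y1: "y1 = d * b" by (auto simp: d_def a_def b_def)
  have "0 < a" using pos(1) d unfolding x1 by (simp add: zero_less_mult_iff)
  have ab: "coprime a b" unfolding a_def b_def d_def using pos by (intro div_gcd_coprime) auto
  have ax0: "coprime a x0" using cop(1) unfolding x1 by (simp add: coprime_commute)
  have dx0: "coprime d x0" using cop(1) unfolding x1 by (simp add: coprime_commute)
  have dy0: "coprime d y0" using cop(2) unfolding y1 by (simp add: coprime_commute)
  have small: "c = 0" if "e dvd c" "\<bar>c\<bar> \<le> H" "H < e" for c e :: int
    using dvd_imp_le_int[OF _ that(1)] that(2,3) by fastforce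
  have le: "a \<le> H" if "a dvd c" "\<bar>c\<bar> \<le> H" "c \<noteq> 0" for c
    using dvd_imp_le_int[OF that(3,1)] that(2) by linarith
  have "d * (c0 * (x0\<^sup>2 * b) + a * (c1 * (x0 * y0) + c2 * (x0 * y1) + c3 * (x1 * y0) + c4 * (x1 * y1))) = 0"
    using F unfolding x1 y1 by (simp add: algebra_simps power2_eq_square)
  then have "c0 * (x0\<^sup>2 * b) + a * (c1 * (x0 * y0) + c2 * (x0 * y1) + c3 * (x1 * y0) + c4 * (x1 * y1)) = 0"
    using d by (metis less_irrefl mult_eq_0_iff)
  then have "c0 * (x0\<^sup>2 * b) = a * - (c1 * (x0 * y0) + c2 * (x0 * y1) + c3 * (x1 * y0) + c4 * (x1 * y1))"
    by (simp only: mult_minus_right eq_neg_iff_add_eq_0)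
  then have "a dvd c0 * (x0\<^sup>2 * b)" by (metis dvd_triv_left)
  moreover have "coprime a (x0\<^sup>2 * b)" using ab ax0 by simp
  ultimately have a_c0: "a dvd c0" by (simp add: coprime_dvd_mult_left_iff)
  show ?thesis
  proof (cases "c0 = 0")
    case False
    then show ?thesis using le[OF a_c0 c(1)] by (simp add: a_def d_def)
  next
    case c0: True
    have "x1 * (x0 * (c1 * y0 + c2 * y1) + x1 * (c3 * y0 + c4 * y1)) = 0"
      using F c0 by (simp add: algebra_simps power2_eq_square)
    then have F1: "x0 * (c1 * y0 + c2 * y1) + x1 * (c3 * y0 + c4 * y1) = 0" using pos by simp
    then have "c1 * (x0 * y0) = d * - (x0 * c2 * b + a * (c3 * y0 + c4 * y1))"
      unfolding x1 y1 by (simp add: algebra_simps)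
    then have "d dvd c1 * (x0 * y0)" by (metis dvd_triv_left)
    moreover have "coprime d (x0 * y0)" using dx0 dy0 by simp
    ultimately have "d dvd c1" by (simp add: coprime_dvd_mult_left_iff)
    then have c1: "c1 = 0" using small c(2) H by (simp add: d_def)
    have "d * (c2 * (x0 * b) + a * (c3 * y0 + c4 * y1)) = 0"
      using F1 c1 unfolding x1 y1 by (simp add: algebra_simps)
    then have "c2 * (x0 * b) + a * (c3 * y0 + c4 * y1) = 0" using d by (metis less_irrefl mult_eq_0_iff)
    then have "c2 * (x0 * b) = a * - (c3 * y0 + c4 * y1)" by (simp only: mult_minus_right eq_neg_iff_add_eq_0)
    then have "a dvd c2 * (x0 * b)" by (metis dvd_triv_left)
    moreover have "coprime a (x0 * b)" using ab ax0 by simp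
    ultimately have a_c2: "a dvd c2" by (simp add: coprime_dvd_mult_left_iff)
    show ?thesis
    proof (cases "c2 = 0")
      case False
      then show ?thesis using le[OF a_c2 c(3)] by (simp add: a_def d_def)
    next
      case c2: True
      have F2: "c3 * y0 + c4 * y1 = 0" using F1 c1 c2 pos by simp
      then have "c3 * y0 = y1 * - c4" by (simp add: algebra_simps)
      then have "y1 dvd c3 * y0" by (metis dvd_triv_left)
      then have "y1 dvd c3" using cop(2) by (simp add: coprime_dvd_mult_left_iff coprime_commute)
      moreover have "H < y1" using H pos gcd_le2_int[of y1 x1] by linarith
      ultimately have "c3 = 0" using small c(4) by blast
      then have "c4 = 0" using F2 pos by simp
      then show ?thesis using nz c0 c1 c2 \<open>c3 = 0\<close> by simp
    qed
  qed
qed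

section \<open>The least common multiple of the denominators\<close>

text \<open>\<open>gcd_ge\<close> is the bound d_n \<ge> Q^(2/3), cubed to stay in the integers. The
  constant C is the bound \<open>H\<close> on the coefficients of F.\<close>

lemma lcm_cf_denom_even_le:
  fixes \<alpha> \<beta> :: real and M :: int
  assumes irr: "\<alpha> \<notin> \<rat>" "\<beta> \<notin> \<rat>"
    and M\<alpha>: "\<And>k. k \<ge> 1 \<Longrightarrow> cf_partial_quotient \<alpha> k \<le> M"
    and M\<beta>: "\<And>k. k \<ge> 1 \<Longrightarrow> cf_partial_quotient \<beta> k \<le> M"
    and le: "\<forall>\<^sub>F n in sequentially. cf_denom \<alpha> (2 * n) \<le> cf_denom \<beta> (2 * n)"
    and gcd_ge: "\<forall>\<^sub>F n in sequentially.
      (cf_denom \<beta> (2 * n))\<^sup>2 \<le> gcd (cf_denom \<alpha> (2 * n)) (cf_denom \<beta> (2 * n)) ^ 3"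
  shows "\<exists>C>0. \<forall>\<^sub>F n in sequentially.
      lcm (cf_denom \<alpha> (2 * n)) (cf_denom \<beta> (2 * n)) \<le> C * cf_denom \<beta> (2 * n)"
proof -
  have M: "1 \<le> M" using cf_partial_quotient_ge_1[OF irr(1), of 1] M\<alpha>[of 1] by linarith
  \<comment> \<open>\<open>B\<close> covers four double steps of the recursion; \<open>H\<close> is
    the Siegel bound for 4 equations in 5 unknowns with entries at most \<open>B ^ 3\<close>;
    \<open>g\<close> is a common multiple of all possible pairwise gcds; \<open>G\<close> collects
    the constants in the final size comparison.\<close>
  define B where "B = (M + 1) ^ 8"
  define H where "H = (2 * 5 * B ^ 3 + 1) ^ 4"
  define g :: int where "g = fact (nat B)"
  define G where "G = g ^ 25 * ((B ^ 3) ^ 4 * (5 * H))"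
  have B: "1 \<le> B" unfolding B_def using M by (intro one_le_power) simp
  have Bpow: "(M + 1) ^ j \<le> B" if "j \<le> 8" for j
    unfolding B_def using that M by (intro power_increasing) auto
  have H: "1 \<le> H" unfolding H_def using B by (intro one_le_power) simp
  have g: "0 < g" by (simp add: g_def)
  define d where "d n = gcd (cf_denom \<alpha> (2 * n)) (cf_denom \<beta> (2 * n))" for n
  obtain N where N: "\<And>n. n \<ge> N \<Longrightarrow> cf_denom \<alpha> (2 * n) \<le> cf_denom \<beta> (2 * n)"
      "\<And>n. n \<ge> N \<Longrightarrow> (cf_denom \<beta> (2 * n))\<^sup>2 \<le> d n ^ 3"
    using eventually_conj[OF le gcd_ge] unfolding eventually_sequentially d_def by blast
  have "lcm (cf_denom \<alpha> (2 * n)) (cf_denom \<beta> (2 * n)) \<le> H * cf_denom \<beta> (2 * n)"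
    \<comment> \<open>The summand 1 makes 2n - 1 a true predecessor; the others make
      \<open>y1\<close> exceed \<open>H ^ 3\<close> and \<open>G ^ 3\<close>.\<close>
    if n: "n \<ge> N + 1 + nat (H ^ 3) + nat (G ^ 3)" for n
  proof -
    define x0 x1 y0 y1 where "x0 = cf_denom \<alpha> (2 * n - 1)" and "x1 = cf_denom \<alpha> (2 * n)"
      and "y0 = cf_denom \<beta> (2 * n - 1)" and "y1 = cf_denom \<beta> (2 * n)"
    have suc: "2 * n = Suc (2 * n - 1)" using n by simp
    have cop: "coprime x0 x1" "coprime y0 y1"
      unfolding x0_def x1_def y0_def y1_def using coprime_cf_denom_Suc suc by metis+
    have pos: "0 < x0" "0 < x1" "0 < y0" "0 < y1"
      unfolding x0_def x1_def y0_def y1_def using cf_denom_pos irr by auto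
    have "x0 \<le> x1" "y0 \<le> y1" "x1 \<le> y1"
      unfolding x0_def x1_def y0_def y1_def using N(1)[of n] n cf_denom_mono irr by auto
    then have small: "x0 \<le> y1" "x1 \<le> y1" "y0 \<le> y1" by auto
    have y1_gt: "H ^ 3 < y1" "G ^ 3 < y1"
      using cf_denom_even_ge[OF irr(2), of n] n unfolding y1_def by linarith+
    have d_pos: "0 < d k" for k unfolding d_def using cf_denom_pos[OF irr(1), of "2 * k"] by simp
    have dn: "d n = gcd x1 y1" by (simp add: d_def x1_def y1_def)
    \<comment> \<open>Denominators do not decrease, so one lower bound in \<open>y1\<close> serves
      all five gcds.\<close>
    have d_ge: "y1\<^sup>2 \<le> d (n + i) ^ 3" for i
    proof -
      have "y1 \<le> cf_denom \<beta> (2 * (n + i))" unfolding y1_def by (intro cf_denom_mono irr) simp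
      then have "y1\<^sup>2 \<le> (cf_denom \<beta> (2 * (n + i)))\<^sup>2" using pos by (intro power_mono) auto
      then show ?thesis using N(2)[of "n + i"] n by linarith
    qed

    have block: "\<exists>u v. 0 \<le> u \<and> u \<le> B \<and> 1 \<le> v \<and> v \<le> B \<and>
        cf_denom \<theta> (2 * (n + Suc i)) = u * cf_denom \<theta> (2 * n - 1) + v * cf_denom \<theta> (2 * n)"
      if "i < 4" "\<theta> \<notin> \<rat>" "\<And>k. k \<ge> 1 \<Longrightarrow> cf_partial_quotient \<theta> k \<le> M" for i \<theta>
    proof -
      have "Suc (2 * n - 1) + 2 * Suc i = 2 * (n + Suc i)" using suc by simp
      moreover have "(M + 1) ^ (2 * Suc i) \<le> B" using that(1) by (intro Bpow) simp
      ultimately show ?thesis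
        using cf_denom_block[OF that(2,3), of "2 * Suc i" "2 * n - 1"] suc by (metis order_trans)
    qed
    obtain u v where uv: "\<And>i. i < 4 \<Longrightarrow> 0 \<le> u i \<and> u i \<le> B \<and> 1 \<le> v i \<and> v i \<le> B \<and>
        cf_denom \<alpha> (2 * (n + Suc i)) = u i * x0 + v i * x1"
      using block[OF _ irr(1) M\<alpha>] unfolding x0_def x1_def by metis
    obtain s t where st: "\<And>i. i < 4 \<Longrightarrow> 0 \<le> s i \<and> s i \<le> B \<and> 1 \<le> t i \<and> t i \<le> B \<and>
        cf_denom \<beta> (2 * (n + Suc i)) = s i * y0 + t i * y1"
      using block[OF _ irr(2) M\<beta>] unfolding y0_def y1_def by metis

    \<comment> \<open>Row i holds the five monomials evaluated at the common zero for k = i + 1. The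
      condition for k = 0 is already built in by leaving out \<open>x0\<^sup>2 * y0\<close>.\<close>
    define A where "A i j = [(v i)\<^sup>2 * - s i, v i * - u i * t i, v i * u i * s i, (u i)\<^sup>2 * t i,
        (u i)\<^sup>2 * - s i] ! j" for i j
    have five: "(\<Sum>j<5. f j) = f 0 + f 1 + f 2 + f 3 + f 4" for f :: "nat \<Rightarrow> int"
      by (simp add: eval_nat_numeral)
    have mult3: "\<bar>p\<bar> * \<bar>q\<bar> * \<bar>r\<bar> \<le> B ^ 3" if "\<bar>p\<bar> \<le> B" "\<bar>q\<bar> \<le> B" "\<bar>r\<bar> \<le> B" for p q r :: int
      unfolding power3_eq_cube using that B by (intro mult_mono) auto
    have A_le: "\<bar>A i j\<bar> \<le> int (nat (B ^ 3))" if "i < 4" "j < 5" for i j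
    proof -
      have le: "\<bar>u i\<bar> \<le> B" "\<bar>v i\<bar> \<le> B" "\<bar>s i\<bar> \<le> B" "\<bar>t i\<bar> \<le> B" using uv[OF that(1)] st[OF that(1)] by linarith+
      have "j = 0 \<or> j = 1 \<or> j = 2 \<or> j = 3 \<or> j = 4" using that(2) by linarith
      then have "\<bar>A i j\<bar> \<le> B ^ 3"
        unfolding A_def
        using mult3[OF le(2,2,3)] mult3[OF le(2,1,4)] mult3[OF le(2,1,3)] mult3[OF le(1,1,4)] mult3[OF le(1,1,3)]
        by (elim disjE) (simp_all add: abs_mult power2_eq_square)
      then show ?thesis by linarith
    qed
    obtain c where c: "\<And>j. j < 5 \<Longrightarrow> \<bar>c j\<bar> \<le> H" and c_nz: "\<exists>j<5. c j \<noteq> 0"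
        and c_eq: "\<And>i. i < 4 \<Longrightarrow> (\<Sum>j<5. A i j * c j) = 0"
    proof -
      have "(2 * int 5 * int (nat (B ^ 3)) + 1) ^ 4 = H" using B by (simp add: H_def)
      then show ?thesis using siegel_pigeonhole[of 4 5 A "nat (B ^ 3)", OF _ A_le] that by auto
    qed
    define F where "F = c 0 * (x0\<^sup>2 * y1) + c 1 * (x0 * x1 * y0) + c 2 * (x0 * x1 * y1) +
        c 3 * (x1\<^sup>2 * y0) + c 4 * (x1\<^sup>2 * y1)"

    have "F = 0"
    proof (rule ccontr)
      assume "F \<noteq> 0"
      define W where "W = (\<Prod>i<4. (v i)\<^sup>2 * t i)"
      have W_factor: "0 < (v i)\<^sup>2 * t i" "(v i)\<^sup>2 * t i \<le> B ^ 3" if "i < 4" for i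
        using uv[OF that] st[OF that] mult3[of "v i" "v i" "t i"] by (auto simp: power2_eq_square)
      have W: "0 < W" "W \<le> (B ^ 3) ^ 4"
      proof -
        show "0 < W" unfolding W_def using W_factor by (intro prod_pos) auto
        have "W \<le> (\<Prod>i<4::nat. B ^ 3)"
          unfolding W_def using W_factor by (intro prod_mono) (auto intro: less_imp_le)
        then show "W \<le> (B ^ 3) ^ 4" by simp
      qed
      have "d (n + i) dvd W * F" if "i < 5" for i
      proof (cases i)
        case 0
        \<comment> \<open>Every remaining monomial contains \<open>x1\<close> or
          \<open>y1\<close>.\<close>
        have "d n dvd x1" "d n dvd y1" by (simp_all add: dn)
        then have "d n dvd F" unfolding F_def power2_eq_square
          by (intro dvd_add) (simp_all add: dvd_mult dvd_mult2)
        then show ?thesis by (simp add: 0 dvd_mult)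
      next
        case (Suc k)
        then have k: "k < 4" using that by simp
        have "d (n + Suc k) dvd u k * x0 + v k * x1" "d (n + Suc k) dvd s k * y0 + t k * y1"
          unfolding d_def using uv[OF k] st[OF k] by (metis gcd_dvd1 gcd_dvd2)+
        moreover have "c 0 * ((v k)\<^sup>2 * - s k) + c 1 * (v k * - u k * t k) + c 2 * (v k * u k * s k) +
            c 3 * ((u k)\<^sup>2 * t k) + c 4 * ((u k)\<^sup>2 * - s k) = 0"
          using c_eq[OF k] unfolding five A_def by (simp add: algebra_simps)
        ultimately have "d (n + Suc k) dvd (v k)\<^sup>2 * t k * F"
          unfolding F_def by (rule dvd_form_of_vanishing)
        also have "\<dots> dvd W * F" unfolding W_def using k by (intro mult_dvd_mono dvd_prodI) auto
        finally show ?thesis by (simp add: Suc)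
      qed
      moreover have "gcd (d (n + i)) (d (n + j)) dvd g" if "i < j" "j < 5" for i j
      proof -
        let ?e = "gcd (d (n + i)) (d (n + j))"
        let ?h = "gcd (cf_denom \<alpha> (2 * (n + i))) (cf_denom \<alpha> (2 * (n + j)))"
        \<comment> \<open>The denominators of \<alpha> alone already bound this gcd; the largest
          exponent that occurs is 2 * 4 - 1 = 7.\<close>
        have "?e dvd ?h"
          unfolding d_def by (meson dvd_trans gcd_dvd1 gcd_dvd2 gcd_greatest)
        moreover have "0 < ?h" using cf_denom_pos[OF irr(1), of "2 * (n + i)"] by simp
        ultimately have "?e \<le> ?h" by (rule zdvd_imp_le)
        also have "\<dots> \<le> B"
        proof -
          have "2 * (n + j) = Suc (2 * (n + i)) + (2 * (j - i) - 1)" using that by simp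
          then have "?h \<le> (M + 1) ^ (2 * (j - i) - 1)" using gcd_cf_denom_le[OF irr(1) M\<alpha>] by metis
          also have "\<dots> \<le> B" using that by (intro Bpow) simp
          finally show ?thesis .
        qed
        finally have "nat ?e \<le> nat B" by simp
        moreover have e_pos: "0 < ?e" using d_pos[of "n + i"] by simp
        ultimately have "nat ?e dvd fact (nat B)" by (intro dvd_fact) linarith+
        then have "int (nat ?e) dvd int (fact (nat B))" by (simp only: int_dvd_int_iff)
        then show ?thesis using e_pos by (simp add: g_def)
      qed
      ultimately have "(\<Prod>i<5. d (n + i)) dvd g ^ (5 * 5) * (W * F)"
        by (rule prod_dvd_of_gcd_dvd)
      then have "(\<Prod>i<5. d (n + i)) \<le> \<bar>g ^ 25 * (W * F)\<bar>"
        using g W \<open>F \<noteq> 0\<close> by (intro order_trans[OF abs_ge_self dvd_imp_le_int]) auto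
      also have "\<dots> = g ^ 25 * (W * \<bar>F\<bar>)" using g W by (simp add: abs_mult)
      also have "\<dots> \<le> g ^ 25 * ((B ^ 3) ^ 4 * (5 * H * y1 ^ 3))"
      proof -
        have mono: "\<bar>c j * (p * q * r)\<bar> \<le> H * y1 ^ 3"
          if "j < 5" "0 < p" "p \<le> y1" "0 < q" "q \<le> y1" "0 < r" "r \<le> y1" for j p q r
        proof -
          have "p * q * r \<le> y1 ^ 3" unfolding power3_eq_cube using that by (intro mult_mono) auto
          then show ?thesis unfolding abs_mult using c[OF that(1)] that H by (intro mult_mono) auto
        qed
        have tri: "\<bar>a1 + a2 + a3 + a4 + a5\<bar> \<le> 5 * K"
          if "\<bar>a1\<bar> \<le> K" "\<bar>a2\<bar> \<le> K" "\<bar>a3\<bar> \<le> K" "\<bar>a4\<bar> \<le> K" "\<bar>a5\<bar> \<le> K" for a1 a2 a3 a4 a5 K :: int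
          using that by linarith
        have "\<bar>F\<bar> \<le> 5 * (H * y1 ^ 3)"
          unfolding F_def power2_eq_square by (intro tri mono pos small order_refl) simp_all
        then show ?thesis using W g B by (intro mult_left_mono mult_mono) auto
      qed
      also have "\<dots> = G * y1 ^ 3" by (simp add: G_def)
      finally have "(\<Prod>i<5. d (n + i)) ^ 3 \<le> (G * y1 ^ 3) ^ 3"
        using d_pos by (intro power_mono prod_nonneg) (auto intro: less_imp_le)
      moreover have "(y1\<^sup>2) ^ 5 \<le> (\<Prod>i<5. d (n + i)) ^ 3"
      proof -
        have "(\<Prod>i<5::nat. y1\<^sup>2) \<le> (\<Prod>i<5. d (n + i) ^ 3)" using d_ge by (intro prod_mono) auto
        then show ?thesis by (simp add: prod_power_distrib)
      qed
      \<comment> \<open>Cubed, the lower bound for the product is y1^10 and the upper bound is G^3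
        y1^9, which contradicts the choice of n.\<close>
      ultimately have "y1 * y1 ^ 9 \<le> G ^ 3 * y1 ^ 9"
        by (simp add: power_mult_distrib power_mult[symmetric] power_Suc[symmetric] del: power_Suc)
      then have "y1 \<le> G ^ 3" using pos by simp
      then show False using y1_gt by simp
    qed
    moreover have "H < gcd x1 y1"
    proof (rule ccontr)
      assume "\<not> H < gcd x1 y1"
      then have "gcd x1 y1 ^ 3 \<le> H ^ 3" by (intro power_mono) auto
      moreover have "1 * y1 \<le> y1\<^sup>2" unfolding power2_eq_square using pos by (intro mult_right_mono) auto
      ultimately show False using d_ge[of 0] y1_gt by (simp add: dn)
    qed
    moreover have "c 0 \<noteq> 0 \<or> c 1 \<noteq> 0 \<or> c 2 \<noteq> 0 \<or> c 3 \<noteq> 0 \<or> c 4 \<noteq> 0"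
    proof -
      obtain j where "j < 5" "c j \<noteq> 0" using c_nz by blast
      moreover have "j = 0 \<or> j = 1 \<or> j = 2 \<or> j = 3 \<or> j = 4" using \<open>j < 5\<close> by linarith
      ultimately show ?thesis by auto
    qed
    ultimately have "x1 div gcd x1 y1 \<le> H"
      using cofactor_le_of_form_eq_0[OF cop, of "c 0" "c 1" "c 2" "c 3" "c 4" H] pos c
      unfolding F_def by simp
    moreover have "lcm x1 y1 = x1 div gcd x1 y1 * y1"
      using pos by (simp add: lcm_altdef_int dvd_div_mult)
    ultimately show ?thesis using pos unfolding x1_def y1_def by (simp add: mult_right_mono)
  qed
  then show ?thesis using H unfolding eventually_sequentially by (intro exI[of _ H]) auto
qed

section \<open>The Littlewood conjecture\<close>

lemma littlewood_pairI:
  assumes "\<And>\<epsilon> N. 0 < \<epsilon> \<Longrightarrow> \<exists>n\<ge>N. real n * dist_nearest_int (real n * \<alpha>) * dist_nearest_int (real n * \<beta>) \<le> \<epsilon>"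
  shows "littlewood_pair \<alpha> \<beta>"
proof -
  define f where "f n = real n * dist_nearest_int (real n * \<alpha>) * dist_nearest_int (real n * \<beta>)" for n
  have nonneg: "0 \<le> f n" for n by (simp add: f_def dist_nearest_int_def)
  have small: "liminf (\<lambda>n. ereal (f n)) \<le> ereal \<epsilon>" if "0 < \<epsilon>" for \<epsilon>
  proof (rule ccontr)
    assume "\<not> liminf (\<lambda>n. ereal (f n)) \<le> ereal \<epsilon>"
    then have "\<forall>\<^sub>F n in sequentially. ereal \<epsilon> < ereal (f n)" by (intro less_LiminfD) simp
    then obtain N where "\<And>n. n \<ge> N \<Longrightarrow> \<epsilon> < f n" by (auto simp: eventually_sequentially)
    then show False using assms[OF that, of N] unfolding f_def by (meson not_le)
  qed
  have "liminf (\<lambda>n. ereal (f n)) \<le> 0"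
    by (rule ereal_le_epsilon2) (simp add: small)
  moreover have "0 \<le> liminf (\<lambda>n. ereal (f n))"
    using nonneg by (intro Liminf_bounded) simp
  ultimately show ?thesis unfolding littlewood_pair_def f_def by (rule antisym)
qed

text \<open>The lcm is a multiple of both denominators, so it is a single integer near which both
  \<alpha> and \<beta> are well approximated.\<close>

lemma littlewood_product_lcm_le:
  fixes \<alpha> \<beta> :: real
  assumes irr: "\<alpha> \<notin> \<rat>" "\<beta> \<notin> \<rat>" and "l = lcm (cf_denom \<alpha> (Suc j)) (cf_denom \<beta> (Suc k))"
  shows "real_of_int l * dist_nearest_int (of_int l * \<alpha>) * dist_nearest_int (of_int l * \<beta>)
      \<le> of_int l ^ 3 / ((of_int (cf_denom \<alpha> (Suc j)))\<^sup>2 * (of_int (cf_denom \<beta> (Suc k)))\<^sup>2)"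
proof -
  have l: "0 \<le> l" "cf_denom \<alpha> (Suc j) dvd l" "cf_denom \<beta> (Suc k) dvd l" using assms(3) by auto
  have "real_of_int l * dist_nearest_int (of_int l * \<alpha>) * dist_nearest_int (of_int l * \<beta>)
      \<le> of_int l * (of_int l / (of_int (cf_denom \<alpha> (Suc j)))\<^sup>2) * (of_int l / (of_int (cf_denom \<beta> (Suc k)))\<^sup>2)"
    using l irr dist_nearest_int_multiple_cf_denom
    by (intro mult_mono mult_left_mono) (auto simp: dist_nearest_int_def)
  then show ?thesis by (simp add: power3_eq_cube)
qed

theorem theorem1p1:
  fixes \<alpha> \<beta> :: real and \<eta> :: "nat \<Rightarrow> real"
  assumes "bounded_partial_quotients \<alpha>" and "bounded_partial_quotients \<beta>"
    and "\<And>n. n \<ge> 1 \<Longrightarrow> 0 \<le> \<eta> n \<and> \<eta> n < 1 / 3"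
    and "\<forall>\<^sub>F n in sequentially.
           real_of_int (cf_denom \<beta> (2 * n)) powr (11 / 12 + \<eta> n / 4) \<le> real_of_int (cf_denom \<alpha> (2 * n))
           \<and> cf_denom \<alpha> (2 * n) \<le> cf_denom \<beta> (2 * n)"
    and "\<forall>\<^sub>F n in sequentially.
           real_of_int (lcm (cf_denom \<alpha> (2 * n)) (cf_denom \<beta> (2 * n)))
             \<le> real_of_int (cf_denom \<beta> (2 * n)) powr (1 + \<eta> n)"
  shows "littlewood_pair \<alpha> \<beta>"
proof -
  define q Q where "q n = cf_denom \<alpha> (2 * n)" and "Q n = cf_denom \<beta> (2 * n)" for n
  obtain M1 M2 where irr: "\<alpha> \<notin> \<rat>" "\<beta> \<notin> \<rat>"
    and M1: "\<And>k. k \<ge> 1 \<Longrightarrow> cf_partial_quotient \<alpha> k \<le> M1"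
    and M2: "\<And>k. k \<ge> 1 \<Longrightarrow> cf_partial_quotient \<beta> k \<le> M2"
    using assms(1,2) unfolding bounded_partial_quotients_def by auto
  have q: "0 < q n" and Q: "int n < Q n" "0 < Q n" for n
    unfolding q_def Q_def using cf_denom_pos cf_denom_even_ge irr by auto
  have lower: "\<forall>\<^sub>F n in sequentially. Q n powr (11 / 12 + \<eta> n / 4) \<le> q n"
    and le: "\<forall>\<^sub>F n in sequentially. q n \<le> Q n"
    using assms(4) unfolding q_def Q_def eventually_conj_iff by auto
  have upper: "\<forall>\<^sub>F n in sequentially. lcm (q n) (Q n) \<le> Q n powr (1 + \<eta> n)"
    using assms(5) by (simp add: q_def Q_def)
  have "\<forall>\<^sub>F n in sequentially. (Q n)\<^sup>2 \<le> gcd (q n) (Q n) ^ 3"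
    using lower upper eventually_ge_at_top[of 1]
  proof eventually_elim
    case (elim n)
    let ?Q = "real_of_int (Q n)" and ?d = "real_of_int (gcd (q n) (Q n))"
    have Q1: "1 \<le> ?Q" using Q[of n] by simp
    have "?Q powr (11 / 12 + \<eta> n / 4) * ?Q \<le> q n * ?Q"
      using elim Q1 by (intro mult_right_mono) auto
    also have "real_of_int (q n) * ?Q = ?d * lcm (q n) (Q n)"
    proof -
      have "q n * Q n = gcd (q n) (Q n) * lcm (q n) (Q n)"
        using q[of n] Q[of n] by (simp add: prod_gcd_lcm_int[symmetric])
      then show ?thesis by (metis of_int_mult)
    qed
    also have "\<dots> \<le> ?d * ?Q powr (1 + \<eta> n)" using elim by (intro mult_left_mono) auto
    finally have "?Q powr (23 / 12 + \<eta> n / 4) \<le> ?d * ?Q powr (1 + \<eta> n)"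
      using Q1 powr_add[of ?Q "11 / 12 + \<eta> n / 4" 1] by (simp add: add.commute)
    \<comment> \<open>The exponents compare exactly when \<eta> \<le> 1/3: the condition 5/3 +
      \<eta> \<le> 23/12 + \<eta>/4 reads 3\<eta>/4 \<le> 1/4.\<close>
    moreover have "?Q powr (2 / 3) * ?Q powr (1 + \<eta> n) \<le> ?Q powr (23 / 12 + \<eta> n / 4)"
      unfolding powr_add[symmetric] using Q1 assms(3)[of n] elim by (intro powr_mono) auto
    ultimately have "?Q powr (2 / 3) * ?Q powr (1 + \<eta> n) \<le> ?d * ?Q powr (1 + \<eta> n)" by linarith
    then have "?Q powr (2 / 3) \<le> ?d" using Q1 by simp
    then have "(?Q powr (2 / 3)) ^ 3 \<le> ?d ^ 3" by (intro power_mono) auto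
    moreover have "(?Q powr (2 / 3)) ^ 3 = ?Q\<^sup>2"
      using Q1 by (simp add: powr_power)
    ultimately have "real_of_int ((Q n)\<^sup>2) \<le> real_of_int (gcd (q n) (Q n) ^ 3)" by simp
    then show ?case by (simp only: of_int_le_iff)
  qed
  then have "\<exists>C>0. \<forall>\<^sub>F n in sequentially. lcm (q n) (Q n) \<le> C * Q n"
    using le M1 M2 unfolding q_def Q_def
    by (intro lcm_cf_denom_even_le[OF irr, of "max M1 M2"]) (simp_all add: le_max_iff_disj)
  then obtain C where C: "0 < C" "\<forall>\<^sub>F n in sequentially. lcm (q n) (Q n) \<le> C * Q n"
    by blast
  show ?thesis
  proof (rule littlewood_pairI)
    fix \<epsilon> :: real and N :: nat
    assume "0 < \<epsilon>"
    have "filterlim (\<lambda>n. real_of_int (Q n)) at_top sequentially"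
    proof (intro filterlim_at_top_mono[OF filterlim_real_sequentially] always_eventually allI)
      show "real n \<le> real_of_int (Q n)" for n using Q(1)[of n] by linarith
    qed
    \<comment> \<open>The exponent is 3 - 11/6 - 2 = -5/6, from l \<le> C Q and q^2 \<ge>
      Q^(11/6).\<close>
    then have "((\<lambda>n. real_of_int C ^ 3 * real_of_int (Q n) powr (-5/6)) \<longlongrightarrow> real_of_int C ^ 3 * 0) sequentially"
      by (intro tendsto_mult tendsto_const tendsto_neg_powr) simp_all
    then have "\<forall>\<^sub>F n in sequentially. real_of_int C ^ 3 * real_of_int (Q n) powr (-5/6) < \<epsilon>"
      using \<open>0 < \<epsilon>\<close> by (intro order_tendstoD(2)) auto
    then have "\<forall>\<^sub>F n in sequentially. real_of_int C ^ 3 * real_of_int (Q n) powr (-5/6) < \<epsilon> \<and>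
        lcm (q n) (Q n) \<le> C * Q n \<and> Q n powr (11 / 12 + \<eta> n / 4) \<le> q n \<and> N + 1 \<le> n"
      using C(2) lower eventually_ge_at_top[of "N + 1"] by eventually_elim blast
    then obtain n where n: "real_of_int C ^ 3 * real_of_int (Q n) powr (-5/6) < \<epsilon>"
        "lcm (q n) (Q n) \<le> C * Q n" "Q n powr (11 / 12 + \<eta> n / 4) \<le> q n" "N + 1 \<le> n"
      using eventually_happens trivial_limit_sequentially by blast
    define l where "l = lcm (q n) (Q n)"
    have "0 < l" unfolding l_def using q[of n] Q(2)[of n] by (intro lcm_pos_int) auto
    then have l: "0 \<le> l" "Q n \<le> l" by (simp_all add: l_def zdvd_imp_le)
    have Q1: "1 \<le> real_of_int (Q n)" using Q[of n] by simp
    obtain m where m: "2 * n = Suc m" using n(4) by (cases n) auto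
    have "real_of_int (Q n) powr (11 / 12) \<le> Q n powr (11 / 12 + \<eta> n / 4)"
      using Q1 assms(3)[of n] n(4) by (intro powr_mono) auto
    then have "(real_of_int (Q n) powr (11 / 12))\<^sup>2 \<le> (real_of_int (q n))\<^sup>2"
      using n(3) by (intro power_mono) auto
    then have q2: "real_of_int (Q n) powr (11 / 6) \<le> (real_of_int (q n))\<^sup>2"
      using Q1 by (simp add: powr_power)
    have "of_int l * dist_nearest_int (of_int l * \<alpha>) * dist_nearest_int (of_int l * \<beta>)
        \<le> of_int l ^ 3 / ((real_of_int (q n))\<^sup>2 * (real_of_int (Q n))\<^sup>2)"
      using littlewood_product_lcm_le[OF irr, of l m m] unfolding l_def q_def Q_def m by simp
    also have "\<dots> \<le> (real_of_int C * Q n) ^ 3 / (Q n powr (11 / 6) * (real_of_int (Q n))\<^sup>2)"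
    proof (intro frac_le mult_right_mono power_mono q2)
      show "real_of_int l \<le> real_of_int C * Q n"
        using n(2) unfolding l_def by (metis of_int_le_iff of_int_mult)
    qed (use l Q1 C(1) in auto)
    also have "\<dots> = real_of_int C ^ 3 * Q n powr (-5/6)"
    proof -
      have "real_of_int (Q n) = Q n powr (-5/6) * Q n powr (11 / 6)"
        using Q1 by (simp flip: powr_add)
      then have "real_of_int (Q n) ^ 3 = Q n powr (-5/6) * (Q n powr (11 / 6) * (real_of_int (Q n))\<^sup>2)"
        by (simp add: power3_eq_cube power2_eq_square)
      then show ?thesis using Q1 by (simp add: power_mult_distrib)
    qed
    finally have "of_int l * dist_nearest_int (of_int l * \<alpha>) * dist_nearest_int (of_int l * \<beta>) \<le> \<epsilon>"
      using n(1) by linarith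
    \<comment> \<open>The integers l are arbitrarily large because l \<ge> Q_n > n > N.\<close>
    moreover have "N \<le> nat l" using l Q(1)[of n] n(4) by linarith
    ultimately show "\<exists>n\<ge>N. real n * dist_nearest_int (real n * \<alpha>) * dist_nearest_int (real n * \<beta>) \<le> \<epsilon>"
      using l by (intro exI[of _ "nat l"]) simp
  qed
qed

end
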